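(* Let $H\in\mathbb{R}^{n\times n}$ be symmetric with positive diagonal, $D=\operatorname{diag}(H_{11},\dots,H_{nn})$, $A=D^{-1}|H-D|$ (entrywise absolute value), $\rho(A)<1$, $x^*\in\mathbb{R}^n$ and $f(x)=\tfrac12(x-x^* )^\top H(x-x^* )$. (a) For every $c_0\in\mathbb{R}^n$ and $r^{\mathrm{init}}\in\mathbb{R}^n_{>0}$ with $x^*\in\mathcal{B}(c_0,r^{\mathrm{init}})$ and every tie rule, the adaptive rule $$t_k=\min\{r_k,Ar_k\},\quad h_k=\tfrac12(r_k-t_k),\quad r_{k+1}=\tfrac12(r_k+t_k),\quad c_{k+1}=c_k-h_k\odot s_k,\quad r_0=r^{\mathrm{init}},$$ satisfies $x^*\in\mathcal{B}(c_k,r_k)$ and $\mathcal{B}(c_{k+1},r_{k+1})\subseteq\mathcal{B}(c_k,r_k)$ for all $k\ge0$. (b) If $w\in\mathbb{R}^n_{>0}$ and $q<1$ satisfy $Aw\le qw$, then for all $k\ge0$ $$r_k\le C_0\Bigl(\frac{1+q}{2}\Bigr)^kw,\qquad C_0=\max_i\frac{r^{\mathrm{init}}_i}{w_i}.$$ (c) Among one-step rules that choose the new half-size vector $r'$ from $H$ and the current half-size vector $r>0$ before observing the current sign vector, use the displacement $r-r'$ (i.e. $c'=c-(r-r')\odot s$), and are required to retain the target for every admissible centre and every tie, the componentwise smallest possible $r'$ is $$r'_i=\tfrac12\bigl(r_i+\min\{r_i,(Ar)_i\}\bigr),\qquad i=1,\dots,n .$$ That is, this $r'$ retains the target, and any $r'$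 that does is componentwise at least as large.
   Context: Vector inequalities, minima and products $\odot$ are componentwise. $\rho$ is the spectral radius. $\mathcal{B}(c,r)=\{x:|x_i-c_i|\le r_i\ \forall i\}$. In the adaptive rule, $s_k\in\{-1,+1\}^n$ satisfies $s_{k,i}=\operatorname{sign}\partial_if(c_k)$ whenever $\partial_if(c_k)\ne0$; if $\partial_if(c_k)=0$ then $s_{k,i}\in\{-1,+1\}$ is chosen by a tie rule (any rule depending only on query points, sign answers and previous choices). In (c), "retain the target for every admissible centre and every tie" means: for every $c\in\mathbb{R}^n$ with $x^*\in\mathcal{B}(c,r)$ and every $s\in\{-1,+1\}^n$ with $s_i=\operatorname{sign}(H(c-x^* ))_i$ whenever $(H(c-x^* ))_i\ne0$, one has $x^*\in\mathcal{B}(c-(r-r')\odot s,\,r')$ (i.e. $|c_i-(r_i-r'_i)s_i-x_i^*|\le r'_i$ for all $i$). *)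

theory Defs
  imports "HOL-Analysis.Analysis"
begin

definition spectral_radius :: "real ^ 'n ^ 'n \<Rightarrow> real" where
  "spectral_radius M =
     Max {cmod z | z. \<exists>v :: complex ^ 'n. v \<noteq> 0 \<and>
                       (\<chi> i j. complex_of_real (M $ i $ j)) *v v = z *s v}"

(* Empty as soon as some component of r is negative. *)
definition coord_box :: "real ^ 'n \<Rightarrow> real ^ 'n \<Rightarrow> (real ^ 'n) set" where
  "coord_box c r = {x. \<forall>i. \<bar>x $ i - c $ i\<bar> \<le> r $ i}"

definition partial_deriv :: "(real ^ 'n \<Rightarrow> real) \<Rightarrow> 'n \<Rightarrow> real ^ 'n \<Rightarrow> real" where
  "partial_deriv f i c = deriv (\<lambda>u. f (c + u *\<^sub>R axis i 1)) 0"

(* The coordinatewise answers to a sign query at c; the value 0 signals a tie. *)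
definition sign_answer :: "(real ^ 'n \<Rightarrow> real) \<Rightarrow> real ^ 'n \<Rightarrow> real ^ 'n" where
  "sign_answer f c = (\<chi> i. sgn (partial_deriv f i c))"

definition is_sign_vector :: "real ^ 'n \<Rightarrow> bool" where
  "is_sign_vector s \<longleftrightarrow> (\<forall>i. s $ i \<in> {-1, 1})"

(* A round is (query point, sign answer, chosen sign vector).  A tie rule proposes a sign
   vector from all completed rounds (oldest first), the current query point and the current
   sign answer; its proposal is used only in the coordinates where the answer is 0. *)
type_synonym 'n round = "(real ^ 'n) \<times> (real ^ 'n) \<times> (real ^ 'n)"
type_synonym 'n tie_rule = "'n round list \<Rightarrow> real ^ 'n \<Rightarrow> real ^ 'n \<Rightarrow> real ^ 'n"

definition is_tie_rule :: "('n::finite) tie_rule \<Rightarrow> bool" where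
  "is_tie_rule \<tau> \<longleftrightarrow> (\<forall>hist c g. is_sign_vector (\<tau> hist c g))"

definition chosen_sign ::
    "(real ^ 'n \<Rightarrow> real) \<Rightarrow> 'n tie_rule \<Rightarrow> 'n round list \<Rightarrow> real ^ 'n \<Rightarrow> real ^ 'n" where
  "chosen_sign f \<tau> hist c =
     (\<chi> i. if partial_deriv f i c \<noteq> 0 then sgn (partial_deriv f i c)
           else \<tau> hist c (sign_answer f c) $ i)"

definition truncation :: "real ^ 'n ^ 'n \<Rightarrow> real ^ 'n \<Rightarrow> real ^ 'n" where
  "truncation A r = (\<chi> i. min (r $ i) ((A *v r) $ i))"

primrec half_size :: "real ^ 'n ^ 'n \<Rightarrow> real ^ 'n \<Rightarrow> nat \<Rightarrow> real ^ 'n" where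
  "half_size A r0 0 = r0"
| "half_size A r0 (Suc k) =
     (1/2) *\<^sub>R (half_size A r0 k + truncation A (half_size A r0 k))"

definition step_size :: "real ^ 'n ^ 'n \<Rightarrow> real ^ 'n \<Rightarrow> nat \<Rightarrow> real ^ 'n" where
  "step_size A r0 k =
     (1/2) *\<^sub>R (half_size A r0 k - truncation A (half_size A r0 k))"

(* The centre c_k together with the rounds 0, ..., k - 1.
   The product * of vectors is the componentwise one. *)
primrec adaptive_state ::
    "(real ^ 'n \<Rightarrow> real) \<Rightarrow> real ^ 'n ^ 'n \<Rightarrow> 'n tie_rule \<Rightarrow> real ^ 'n \<Rightarrow> real ^ 'n \<Rightarrow> nat
       \<Rightarrow> (real ^ 'n) \<times> 'n round list" where
  "adaptive_state f A \<tau> c0 r0 0 = (c0, [])"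
| "adaptive_state f A \<tau> c0 r0 (Suc k) =
     (let (c, hist) = adaptive_state f A \<tau> c0 r0 k;
          s = chosen_sign f \<tau> hist c
      in (c - step_size A r0 k * s, hist @ [(c, sign_answer f c, s)]))"

definition centre ::
    "(real ^ 'n \<Rightarrow> real) \<Rightarrow> real ^ 'n ^ 'n \<Rightarrow> 'n tie_rule \<Rightarrow> real ^ 'n \<Rightarrow> real ^ 'n \<Rightarrow> nat
       \<Rightarrow> real ^ 'n" where
  "centre f A \<tau> c0 r0 k = fst (adaptive_state f A \<tau> c0 r0 k)"

(* Replacing the half-sizes r by r' with displacement r - r' keeps the target xs,
   for every admissible centre and every resolution of ties. *)
definition retains_target ::
    "real ^ 'n ^ 'n \<Rightarrow> real ^ 'n \<Rightarrow> real ^ 'n \<Rightarrow> real ^ 'n \<Rightarrow> bool" where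
  "retains_target H xs r r' \<longleftrightarrow>
     (\<forall>c s. xs \<in> coord_box c r \<longrightarrow> is_sign_vector s \<longrightarrow>
            (\<forall>i. (H *v (c - xs)) $ i \<noteq> 0 \<longrightarrow> s $ i = sgn ((H *v (c - xs)) $ i)) \<longrightarrow>
            xs \<in> coord_box (c - (r - r') * s) r')"

end

theory Submission
  imports Defs
begin

text \<open>
  Write \<open>e = c - x\<^sup>*\<close> for the error of the centre. The gradient of \<open>f\<close> at \<open>c\<close> is \<open>H e\<close>, and
  dividing its \<open>i\<close>-th component by \<open>H\<^sub>i\<^sub>i\<close> gives \<open>e\<^sub>i\<close> plus a perturbation by the other
  errors. If \<open>\<bar>e\<^sub>j\<bar> \<le> r\<^sub>j\<close> for all \<open>j\<close>, this perturbation is at most \<open>(A r)\<^sub>i\<close> in absolute value. An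
  answer \<open>s\<^sub>i = 1\<close> therefore confines \<open>e\<^sub>i\<close> to \<open>[- t\<^sub>i, r\<^sub>i]\<close> with \<open>t = min {r, A r}\<close>, and
  \<open>s\<^sub>i = -1\<close> confines it to the mirror image. The rule moves the centre to the midpoint of that
  interval and takes half of its length \<open>r\<^sub>i + t\<^sub>i\<close> as the new half-size. Retention follows, and
  the new box is nested in the old one because the displacement is exactly the loss in half-size.

  The interval cannot be shortened: the errors of the other coordinates can be given the signs of
  \<open>H\<^sub>i\<^sub>j\<close> and their full sizes \<open>r\<^sub>j\<close>, so that \<open>e\<^sub>i = - t\<^sub>i\<close> is still compatible with
  \<open>s\<^sub>i = 1\<close> (through a tie if \<open>t\<^sub>i = (A r)\<^sub>i\<close>). Keeping this target after the displacement
  \<open>r\<^sub>i - r'\<^sub>i\<close> forces \<open>2 r'\<^sub>i \<ge> r\<^sub>i + t\<^sub>i\<close>.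

  The rate in terms of \<open>w\<close> is the monotonicity of the nonnegative matrix \<open>A\<close>: from
  \<open>r\<^sub>k \<le> C w\<close> follows \<open>t\<^sub>k \<le> A r\<^sub>k \<le> C q w\<close>, and the average of the two bounds is
  \<open>C (1 + q) / 2 \<cdot> w\<close>.
\<close>

section \<open>The comparison matrix of the Jacobi iteration\<close>

text \<open>
  The entrywise absolute value of the Jacobi iteration matrix \<open>I - D\<^sup>-\<^sup>1 H\<close>.
\<close>

definition jacobi_modulus :: "real ^ 'n ^ 'n \<Rightarrow> real ^ 'n ^ 'n" where
  "jacobi_modulus H = (\<chi> i j. if i = j then 0 else \<bar>H $ i $ j\<bar> / H $ i $ i)"

lemma diagonal_mult_component:
  fixes d :: "'n::finite \<Rightarrow> real" and M :: "real ^ 'm ^ 'n"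
  shows "((\<chi> i j. if i = j then d i else 0) ** M) $ i $ j = d i * M $ i $ j"
  by (simp add: matrix_matrix_mult_def mult_delta_left)

lemma matrix_inv_eqI:
  fixes A :: "'a::semiring_1 ^ 'n ^ 'm"
  assumes "A ** B = mat 1" and "B ** A = mat 1"
  shows "matrix_inv A = B"
proof -
  have "A ** matrix_inv A = mat 1 \<and> matrix_inv A ** A = mat 1"
    unfolding matrix_inv_def by (rule someI, rule conjI) (fact assms)+
  then have "matrix_inv A = (B ** A) ** matrix_inv A" "B ** (A ** matrix_inv A) = B"
    using assms by simp_all
  then show ?thesis
    by (simp add: matrix_mul_assoc)
qed

lemma matrix_inv_diagonal_mult_component:
  fixes d :: "'n::finite \<Rightarrow> real" and M :: "real ^ 'm ^ 'n"
  assumes "\<And>i. d i \<noteq> 0"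
  shows "(matrix_inv (\<chi> i j. if i = j then d i else 0) ** M) $ i $ j = M $ i $ j / d i"
proof -
  let ?D = "(\<chi> i j. if i = j then d i else 0) :: real ^ 'n ^ 'n"
  let ?E = "(\<chi> i j. if i = j then 1 / d i else 0) :: real ^ 'n ^ 'n"
  have "?D ** ?E = mat 1" "?E ** ?D = mat 1"
    using assms
    by (auto simp: mat_def vec_eq_iff diagonal_mult_component[of d]
        diagonal_mult_component[of "\<lambda>i. 1 / d i"])
  then have "matrix_inv ?D = ?E"
    by (rule matrix_inv_eqI)
  then show ?thesis
    by (simp add: diagonal_mult_component[of "\<lambda>i. 1 / d i"])
qed

lemma jacobi_modulus_eq:
  fixes H D :: "real ^ 'n ^ 'n"
  assumes "\<And>i. H $ i $ i > 0"
    and D: "D = (\<chi> i j. if i = j then H $ i $ i else 0)"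
  shows "matrix_inv D ** (\<chi> i j. \<bar>(H - D) $ i $ j\<bar>) = jacobi_modulus H"
proof -
  have "H $ i $ i \<noteq> 0" for i
    using assms(1)[of i] by simp
  then show ?thesis
    by (simp add: vec_eq_iff D jacobi_modulus_def
        matrix_inv_diagonal_mult_component[of "\<lambda>i. H $ i $ i"])
qed

lemma matrix_vector_component_split:
  fixes H :: "real ^ 'n ^ 'n"
  shows "(H *v e) $ i = H $ i $ i * e $ i + (\<Sum>j\<in>UNIV - {i}. H $ i $ j * e $ j)"
  by (simp add: matrix_vector_mult_def sum.remove[of UNIV i])

lemma jacobi_modulus_component:
  fixes H :: "real ^ 'n ^ 'n"
  assumes "H $ i $ i > 0"
  shows "H $ i $ i * (jacobi_modulus H *v r) $ i = (\<Sum>j\<in>UNIV - {i}. \<bar>H $ i $ j\<bar> * r $ j)"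
proof -
  have "(jacobi_modulus H *v r) $ i = (\<Sum>j\<in>UNIV - {i}. \<bar>H $ i $ j\<bar> / H $ i $ i * r $ j)"
    by (simp add: matrix_vector_component_split jacobi_modulus_def)
  then show ?thesis
    using assms by (simp add: sum_distrib_left)
qed

lemma jacobi_modulus_mono:
  fixes H :: "real ^ 'n ^ 'n"
  assumes "\<And>i. H $ i $ i > 0" and "x \<le> y"
  shows "jacobi_modulus H *v x \<le> jacobi_modulus H *v y"
  using assms less_imp_le[OF assms(1)]
  by (auto simp: less_eq_vec_def matrix_vector_mult_def jacobi_modulus_def
      intro!: sum_mono mult_right_mono mult_left_mono divide_right_mono)

lemma jacobi_modulus_nonneg:
  fixes H :: "real ^ 'n ^ 'n"
  assumes "\<And>i. H $ i $ i > 0" and "0 \<le> x"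
  shows "0 \<le> jacobi_modulus H *v x"
  using jacobi_modulus_mono[OF assms] by simp

section \<open>The gradient of the quadratic\<close>

lemma partial_deriv_quadratic:
  fixes H :: "real ^ 'n ^ 'n"
  assumes "transpose H = H"
  shows "partial_deriv (\<lambda>x. 1/2 * ((x - xs) \<bullet> (H *v (x - xs)))) i c = (H *v (c - xs)) $ i"
proof -
  define e where "e = c - xs"
  define a where "a = (axis i 1 :: real ^ 'n)"
  have ae: "a \<bullet> (H *v e) = (H *v e) $ i"
    by (simp add: a_def inner_axis')
  have "e \<bullet> (H *v a) = (e v* H) \<bullet> a"
    by (simp add: dot_lmul_matrix)
  also have "\<dots> = (H *v e) $ i"
    by (metis ae assms inner_commute transpose_matrix_vector)
  finally have ea: "e \<bullet> (H *v a) = (H *v e) $ i" .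
  have "1/2 * ((c + u *\<^sub>R a - xs) \<bullet> (H *v (c + u *\<^sub>R a - xs))) =
      1/2 * (e \<bullet> (H *v e)) + u * (H *v e) $ i + u\<^sup>2 / 2 * (a \<bullet> (H *v a))" for u
  proof -
    have "c + u *\<^sub>R a - xs = e + u *\<^sub>R a" by (simp add: e_def)
    then show ?thesis
      by (simp add: matrix_vector_right_distrib matrix_vector_mult_scaleR inner_add_left
          inner_add_right ae ea power2_eq_square algebra_simps)
  qed
  moreover have "((\<lambda>u. 1/2 * (e \<bullet> (H *v e)) + u * (H *v e) $ i + u\<^sup>2 / 2 * (a \<bullet> (H *v a)))
      has_real_derivative (H *v e) $ i) (at 0)"
    by (auto intro!: derivative_eq_intros)
  ultimately have "deriv (\<lambda>u. 1/2 * ((c + u *\<^sub>R a - xs) \<bullet> (H *v (c + u *\<^sub>R a - xs)))) 0 =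
      (H *v e) $ i"
    by (simp only: DERIV_imp_deriv)
  then show ?thesis
    by (simp only: partial_deriv_def a_def e_def)
qed

section \<open>One step: retention and optimality\<close>

text \<open>
  The off-diagonal part of the \<open>i\<close>-th gradient component is at most \<open>H\<^sub>i\<^sub>i (A r)\<^sub>i\<close>, so the component can
  only be nonnegative if \<open>e\<^sub>i \<ge> - (A r)\<^sub>i\<close>; the box itself gives \<open>e\<^sub>i \<ge> - r\<^sub>i\<close>. A nonpositive
  component is the case of \<open>- e\<close>.
\<close>

lemma error_lower_bound:
  fixes H :: "real ^ 'n ^ 'n"
  assumes "H $ i $ i > 0" and "\<And>j. \<bar>e $ j\<bar> \<le> r $ j" and "(H *v e) $ i \<ge> 0"
  shows "- truncation (jacobi_modulus H) r $ i \<le> e $ i"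
proof -
  have "(\<Sum>j\<in>UNIV - {i}. H $ i $ j * e $ j) \<le> (\<Sum>j\<in>UNIV - {i}. \<bar>H $ i $ j\<bar> * r $ j)"
  proof (rule sum_mono)
    fix j
    have "H $ i $ j * e $ j \<le> \<bar>H $ i $ j\<bar> * \<bar>e $ j\<bar>"
      by (metis abs_ge_self abs_mult)
    also have "\<dots> \<le> \<bar>H $ i $ j\<bar> * r $ j"
      by (simp add: assms(2) mult_left_mono)
    finally show "H $ i $ j * e $ j \<le> \<bar>H $ i $ j\<bar> * r $ j" .
  qed
  then have "0 \<le> H $ i $ i * (e $ i + (jacobi_modulus H *v r) $ i)"
    using assms(3) jacobi_modulus_component[of H i r, OF assms(1)]
    by (simp add: matrix_vector_component_split distrib_left)
  then have "0 \<le> e $ i + (jacobi_modulus H *v r) $ i"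
    using assms(1) by (simp add: zero_le_mult_iff)
  then show ?thesis
    using assms(2)[of i] by (auto simp: truncation_def min_def)
qed

lemma retains_target_halving:
  fixes H :: "real ^ 'n ^ 'n"
  assumes "\<And>i. H $ i $ i > 0"
  shows "retains_target H xs r ((1/2) *\<^sub>R (r + truncation (jacobi_modulus H) r))"
  unfolding retains_target_def
proof (intro allI impI)
  fix c s :: "real ^ 'n"
  define e where "e = c - xs"
  define t where "t = truncation (jacobi_modulus H) r"
  assume box: "xs \<in> coord_box c r" and "is_sign_vector s"
    and sgn: "\<forall>i. (H *v (c - xs)) $ i \<noteq> 0 \<longrightarrow> s $ i = sgn ((H *v (c - xs)) $ i)"
  have e_le: "\<bar>e $ j\<bar> \<le> r $ j" for j
    using box by (simp add: coord_box_def e_def abs_minus_commute)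
  have "\<bar>e $ i - (r $ i - t $ i) / 2 * s $ i\<bar> \<le> (r $ i + t $ i) / 2" for i
  proof -
    consider "s $ i = 1" "(H *v e) $ i \<ge> 0" | "s $ i = -1" "(H *v (- e)) $ i \<ge> 0"
      using \<open>is_sign_vector s\<close> sgn[rule_format, of i]
      by (cases "(H *v e) $ i" "0 :: real" rule: linorder_cases)
        (auto simp: is_sign_vector_def e_def[symmetric] matrix_vector_mult_def sum_negf)
    then show ?thesis
    proof cases
      case 1
      then have "- t $ i \<le> e $ i"
        unfolding t_def using error_lower_bound[of H i e r] assms e_le by blast
      then show ?thesis
        using 1 e_le[of i] by (simp add: abs_le_iff field_simps)
    next
      case 2
      then have "- t $ i \<le> (- e) $ i"
        unfolding t_def using error_lower_bound[of H i "- e" r] assms e_le by simp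
      then show ?thesis
        using 2 e_le[of i] by (simp add: abs_le_iff field_simps)
    qed
  qed
  then show "xs \<in> coord_box (c - (r - (1/2) *\<^sub>R (r + truncation (jacobi_modulus H) r)) * s)
      ((1/2) *\<^sub>R (r + truncation (jacobi_modulus H) r))"
    unfolding t_def[symmetric]
    by (simp add: coord_box_def e_def abs_le_iff field_simps)
qed

text \<open>
  The extremal error for the coordinate \<open>i\<close>: all other errors that enter \<open>(H e)\<^sub>i\<close> have full
  size and the signs that make it largest, which offsets the most negative value of \<open>e\<^sub>i\<close> that the box and a
  nonnegative gradient component permit.
\<close>

lemma retains_target_lower_bound:
  fixes H :: "real ^ 'n ^ 'n"
  assumes diag: "\<And>i. H $ i $ i > 0" and r: "\<And>i. r $ i > 0"
    and ret: "retains_target H xs r r'"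
  shows "(1/2) *\<^sub>R (r + truncation (jacobi_modulus H) r) \<le> r'"
  unfolding less_eq_vec_def
proof
  fix i
  define t where "t = truncation (jacobi_modulus H) r $ i"
  define e where "e = (\<chi> j. if j = i then - t else sgn (H $ i $ j) * r $ j)"
  define s where "s = (\<chi> j. if (H *v e) $ j = 0 then 1 else sgn ((H *v e) $ j))"
  have "0 \<le> (jacobi_modulus H *v r) $ i"
    using jacobi_modulus_nonneg[of H r] diag r by (simp add: less_eq_vec_def less_imp_le)
  then have t: "0 \<le> t" "t \<le> r $ i" "t \<le> (jacobi_modulus H *v r) $ i"
    using r[of i] by (auto simp: t_def truncation_def)
  have box: "xs \<in> coord_box (xs + e) r"
    using t r less_imp_le[OF r] by (auto simp: coord_box_def e_def abs_mult abs_sgn_eq)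
  have "(\<Sum>j\<in>UNIV - {i}. H $ i $ j * e $ j) = (\<Sum>j\<in>UNIV - {i}. \<bar>H $ i $ j\<bar> * r $ j)"
    by (rule sum.cong) (auto simp: e_def abs_sgn)
  then have "(H *v e) $ i = H $ i $ i * ((jacobi_modulus H *v r) $ i - t)"
    using jacobi_modulus_component[of H i r, OF diag]
    by (simp add: matrix_vector_component_split e_def right_diff_distrib)
  then have "(H *v e) $ i \<ge> 0"
    using t diag[of i] by simp
  then have "s $ i = 1"
    by (simp add: s_def)
  have "is_sign_vector s"
    by (auto simp: is_sign_vector_def s_def sgn_if)
  then have "xs \<in> coord_box (xs + e - (r - r') * s) r'"
    using ret box unfolding retains_target_def by (simp add: s_def)
  then have "\<bar>(r $ i - r' $ i) * s $ i - e $ i\<bar> \<le> r' $ i"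
    by (simp add: coord_box_def)
  then have "\<bar>r $ i - r' $ i + t\<bar> \<le> r' $ i"
    using \<open>s $ i = 1\<close> by (simp add: e_def)
  then show "((1/2) *\<^sub>R (r + truncation (jacobi_modulus H) r)) $ i \<le> r' $ i"
    by (simp add: t_def)
qed

section \<open>Iterating the adaptive rule\<close>

lemma coord_box_shift_subset:
  assumes "is_sign_vector s" and "r' \<le> r"
  shows "coord_box (c - (r - r') * s) r' \<subseteq> coord_box c r"
proof
  fix x
  assume x: "x \<in> coord_box (c - (r - r') * s) r'"
  have "\<bar>x $ i - c $ i\<bar> \<le> r $ i" for i
  proof -
    have "\<bar>x $ i - (c $ i - (r $ i - r' $ i) * s $ i)\<bar> \<le> r' $ i"
      using x by (simp add: coord_box_def)
    moreover have "s $ i = 1 \<or> s $ i = -1" "r' $ i \<le> r $ i"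
      using assms by (auto simp: is_sign_vector_def less_eq_vec_def)
    ultimately show ?thesis
      by (auto simp: abs_le_iff)
  qed
  then show "x \<in> coord_box c r"
    by (simp add: coord_box_def)
qed

lemma is_sign_vector_chosen_sign:
  assumes "is_tie_rule \<tau>"
  shows "is_sign_vector (chosen_sign f \<tau> hist c)"
  using assms by (auto simp: is_sign_vector_def chosen_sign_def is_tie_rule_def sgn_if)

lemma step_size_eq_diff: "step_size A r0 k = half_size A r0 k - half_size A r0 (Suc k)"
  by (simp add: step_size_def vec_eq_iff field_simps)

lemma half_size_Suc_le: "half_size A r0 (Suc k) \<le> half_size A r0 k"
  by (simp add: less_eq_vec_def truncation_def)

lemma centre_Suc:
  "\<exists>hist. centre f A \<tau> c0 r0 (Suc k) = centre f A \<tau> c0 r0 k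
      - (half_size A r0 k - half_size A r0 (Suc k)) * chosen_sign f \<tau> hist (centre f A \<tau> c0 r0 k)"
  unfolding step_size_eq_diff[symmetric]
  by (auto simp: centre_def Let_def split: prod.split)

lemma adaptive_nested:
  assumes "is_tie_rule \<tau>"
  shows "coord_box (centre f A \<tau> c0 r0 (Suc k)) (half_size A r0 (Suc k))
    \<subseteq> coord_box (centre f A \<tau> c0 r0 k) (half_size A r0 k)"
  using centre_Suc[of f A \<tau> c0 r0 k]
    coord_box_shift_subset[OF is_sign_vector_chosen_sign[OF assms] half_size_Suc_le]
  by (metis (no_types))

lemma adaptive_retains:
  fixes H :: "real ^ 'n ^ 'n"
  assumes diag: "\<And>i. H $ i $ i > 0" and grad: "\<And>i c. partial_deriv f i c = (H *v (c - xs)) $ i"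
    and tie: "is_tie_rule \<tau>" and init: "xs \<in> coord_box c0 r0"
  defines "A \<equiv> jacobi_modulus H"
  shows "xs \<in> coord_box (centre f A \<tau> c0 r0 k) (half_size A r0 k)"
proof (induction k)
  case 0
  show ?case using init by (simp add: centre_def)
next
  case (Suc k)
  let ?c = "centre f A \<tau> c0 r0 k" and ?r = "half_size A r0"
  obtain hist where c: "centre f A \<tau> c0 r0 (Suc k)
      = ?c - (?r k - ?r (Suc k)) * chosen_sign f \<tau> hist ?c"
    using centre_Suc by blast
  have "retains_target H xs (?r k) (?r (Suc k))"
    using retains_target_halving[of H xs "?r k", OF diag] by (simp add: A_def)
  moreover have "\<forall>i. (H *v (?c - xs)) $ i \<noteq> 0 \<longrightarrow>
      chosen_sign f \<tau> hist ?c $ i = sgn ((H *v (?c - xs)) $ i)"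
    by (simp add: chosen_sign_def grad)
  ultimately show ?case
    unfolding c retains_target_def using Suc.IH is_sign_vector_chosen_sign[OF tie] by blast
qed

section \<open>Geometric decay of the half-sizes\<close>

lemma half_size_decay:
  fixes H :: "real ^ 'n ^ 'n"
  assumes diag: "\<And>i. H $ i $ i > 0" and w: "\<And>i. w $ i > 0"
    and q: "jacobi_modulus H *v w \<le> q *\<^sub>R w"
    and "0 \<le> C" and init: "r0 \<le> C *\<^sub>R w"
  shows "half_size (jacobi_modulus H) r0 k \<le> (C * ((1 + q) / 2) ^ k) *\<^sub>R w"
proof (induction k)
  case 0
  show ?case using init by simp
next
  case (Suc k)
  let ?A = "jacobi_modulus H"
  let ?r = "half_size ?A r0 k" and ?b = "C * ((1 + q) / 2) ^ k"
  have "0 \<le> ?A *v w"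
    using jacobi_modulus_nonneg[of H w] diag w by (simp add: less_eq_vec_def less_imp_le)
  with q have "0 \<le> q *\<^sub>R w"
    by (rule order_trans[rotated])
  \<comment> \<open>The factor \<open>q\<close> inherits nonnegativity from \<open>A w \<ge> 0\<close>, so the bound \<open>A w \<le> q w\<close> can be
    scaled by the current constant.\<close>
  then have "0 \<le> q"
    using w by (simp add: less_eq_vec_def zero_le_mult_iff) (meson not_less)
  then have "0 \<le> ?b"
    using \<open>0 \<le> C\<close> by simp
  have "?A *v ?r \<le> ?A *v (?b *\<^sub>R w)"
    using jacobi_modulus_mono diag Suc.IH by blast
  also have "\<dots> = ?b *\<^sub>R (?A *v w)"
    by (simp add: matrix_vector_mult_scaleR)
  also have "\<dots> \<le> ?b *\<^sub>R (q *\<^sub>R w)"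
    using q \<open>0 \<le> ?b\<close> by (rule scaleR_left_mono)
  finally have Ar: "(?A *v ?r) $ i \<le> ?b * (q * w $ i)" for i
    by (simp add: less_eq_vec_def mult.assoc)
  have "half_size ?A r0 (Suc k) $ i \<le> ((C * ((1 + q) / 2) ^ Suc k) *\<^sub>R w) $ i" for i
  proof -
    have "half_size ?A r0 (Suc k) $ i \<le> (?r $ i + (?A *v ?r) $ i) / 2"
      by (simp add: truncation_def)
    also have "\<dots> \<le> (?b * w $ i + ?b * (q * w $ i)) / 2"
      using Suc.IH Ar[of i] by (simp add: less_eq_vec_def add_mono)
    also have "\<dots> = ((C * ((1 + q) / 2) ^ Suc k) *\<^sub>R w) $ i"
      by (simp add: field_simps)
    finally show ?thesis .
  qed
  then show ?case
    by (simp add: less_eq_vec_def)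
qed

lemma le_Max_ratio_scaleR:
  fixes r w :: "real ^ 'n"
  assumes "\<And>i. w $ i > 0"
  shows "r \<le> Max (range (\<lambda>i. r $ i / w $ i)) *\<^sub>R w"
  unfolding less_eq_vec_def
proof
  fix i
  have "r $ i / w $ i \<le> Max (range (\<lambda>i. r $ i / w $ i))"
    by (rule Max_ge) auto
  then have "r $ i \<le> Max (range (\<lambda>i. r $ i / w $ i)) * w $ i"
    by (simp only: pos_divide_le_eq[OF assms])
  then show "r $ i \<le> (Max (range (\<lambda>i. r $ i / w $ i)) *\<^sub>R w) $ i"
    by simp
qed

theorem theorem4p7:
  fixes H D A :: "real ^ 'n ^ 'n" and xs :: "real ^ 'n" and f :: "real ^ 'n \<Rightarrow> real"
  assumes H_sym: "transpose H = H"
    and H_diag: "\<And>i. H $ i $ i > 0"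
    and D_def: "D = (\<chi> i j. if i = j then H $ i $ i else 0)"
    and A_def: "A = matrix_inv D ** (\<chi> i j. \<bar>(H - D) $ i $ j\<bar>)"
    and rho: "spectral_radius A < 1"
    and f_def: "f = (\<lambda>x. 1/2 * ((x - xs) \<bullet> (H *v (x - xs))))"
  shows "(\<forall>c0 rinit \<tau> k.
            (\<forall>i. rinit $ i > 0) \<longrightarrow> xs \<in> coord_box c0 rinit \<longrightarrow> is_tie_rule \<tau> \<longrightarrow>
              xs \<in> coord_box (centre f A \<tau> c0 rinit k) (half_size A rinit k) \<and>
              coord_box (centre f A \<tau> c0 rinit (Suc k)) (half_size A rinit (Suc k))
                \<subseteq> coord_box (centre f A \<tau> c0 rinit k) (half_size A rinit k))
       \<and> (\<forall>rinit w q k.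
            (\<forall>i. rinit $ i > 0) \<longrightarrow> (\<forall>i. w $ i > 0) \<longrightarrow> q < 1 \<longrightarrow> A *v w \<le> q *\<^sub>R w \<longrightarrow>
              half_size A rinit k
                \<le> (Max (range (\<lambda>i. rinit $ i / w $ i)) * ((1 + q) / 2) ^ k) *\<^sub>R w)
       \<and> (\<forall>r. (\<forall>i. r $ i > 0) \<longrightarrow>
            (let r_opt = (\<chi> i. 1/2 * (r $ i + min (r $ i) ((A *v r) $ i))) in
              retains_target H xs r r_opt \<and>
              (\<forall>r'. retains_target H xs r r' \<longrightarrow> r_opt \<le> r')))"
proof -
  have A: "A = jacobi_modulus H"
    unfolding A_def using jacobi_modulus_eq[OF H_diag D_def] .
  have grad: "partial_deriv f i c = (H *v (c - xs)) $ i" for i c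
    unfolding f_def using partial_deriv_quadratic[OF H_sym] .
  have decay: "half_size A rinit k \<le> (Max (range (\<lambda>i. rinit $ i / w $ i)) * ((1 + q) / 2) ^ k) *\<^sub>R w"
    if "\<forall>i. rinit $ i > 0" "\<forall>i. w $ i > 0" "A *v w \<le> q *\<^sub>R w" for rinit w q k
  proof -
    have "0 \<le> rinit $ i / w $ i" for i
      using that by (simp add: less_imp_le)
    then have "0 \<le> Max (range (\<lambda>i. rinit $ i / w $ i))"
      by (auto simp: Max_ge_iff)
    then show ?thesis
      using that half_size_decay[of H w q _ rinit k, OF H_diag] le_Max_ratio_scaleR[of w rinit]
      by (simp add: A)
  qed
  have opt: "(\<chi> i. 1/2 * (r $ i + min (r $ i) ((A *v r) $ i))) = (1/2) *\<^sub>R (r + truncation A r)" for r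
    by (simp add: vec_eq_iff truncation_def)
  have c: "let r_opt = (\<chi> i. 1/2 * (r $ i + min (r $ i) ((A *v r) $ i))) in
      retains_target H xs r r_opt \<and> (\<forall>r'. retains_target H xs r r' \<longrightarrow> r_opt \<le> r')"
    if "\<forall>i. r $ i > 0" for r
    unfolding opt unfolding Let_def A
    using that retains_target_halving[of H xs r, OF H_diag]
      retains_target_lower_bound[of H r xs, OF H_diag] by blast
  show ?thesis
    using adaptive_retains[of H f xs, OF H_diag grad] adaptive_nested[of _ f A] decay c
    unfolding A by blast
qed

end
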